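(* Let $A$ be an $m\times n$ real matrix, $p\in\mathbb{R}^n$, $b\in\mathbb{R}^m$, and let $\bar{x}\in\mathbb{R}^n$ be an optimal solution of the linear programming problem $$\text{Maximize } p^T x \text{ subject to } Ax=b,\ x\geq 0.$$ Let $I^0(\bar{x})=\{j\in\{1,\ldots,n\}\mid \bar{x}_j=0\}$. Then the following three statements are equivalent: (i) $\bar{x}$ is the unique optimal solution of the problem: Maximize $p^T x$ subject to $Ax=b$, $x\geq 0$. (ii) The vector $0\in\mathbb{R}^n$ is the unique optimal solution of the problem: Maximize $p^T h$ subject to $Ah=0$, $h_j\geq 0$ for all $j\in I^0(\bar{x})$. (iii) For all $q\in\mathbb{R}^n$ with $q\neq 0$, there exists $\varepsilon>0$ such that for all $\delta\in(0,\varepsilon)$, the vector $0\in\mathbb{R}^n$ is an optimal solution of the problem: Maximize $(p+\delta q)^T h$ subject to $Ah=0$, $h_j\geq 0$ for all $j\in I^0(\bar{x})$.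
   Context: For a vector $x$, $x\geq 0$ means that every coordinate of $x$ is nonnegative. In the problems with variable $h\in\mathbb{R}^n$, the coordinates $h_j$ with $j\notin I^0(\bar{x})$ are unconstrained in sign. An optimal solution of a maximization problem is a feasible point at which the maximum of the objective over the feasible set is attained; it is not assumed to be basic. *)

theory Defs
  imports "HOL-Analysis.Analysis"
begin

definition optimal_solution :: "('a \<Rightarrow> real) \<Rightarrow> 'a set \<Rightarrow> 'a \<Rightarrow> bool" where
  "optimal_solution f F x \<longleftrightarrow> is_arg_max f (\<lambda>y. y \<in> F) x"

definition unique_optimal_solution :: "('a \<Rightarrow> real) \<Rightarrow> 'a set \<Rightarrow> 'a \<Rightarrow> bool" where
  "unique_optimal_solution f F x \<longleftrightarrow>
     optimal_solution f F x \<and> (\<forall>y. optimal_solution f F y \<longrightarrow> y = x)"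

definition lp_feasible :: "real ^ 'n ^ 'm \<Rightarrow> real ^ 'm \<Rightarrow> (real ^ 'n) set" where
  "lp_feasible A b = {x. A *v x = b \<and> (\<forall>j. 0 \<le> x $ j)}"

definition zero_indices :: "real ^ 'n \<Rightarrow> 'n set" where
  "zero_indices x = {j. x $ j = 0}"

text \<open>Only the coordinates indexed by \<open>J\<close> are sign-constrained; the others are free.\<close>

definition direction_feasible :: "real ^ 'n ^ 'm \<Rightarrow> 'n set \<Rightarrow> (real ^ 'n) set" where
  "direction_feasible A J = {h. A *v h = 0 \<and> (\<forall>j\<in>J. 0 \<le> h $ j)}"

end

theory Submission
  imports Defs
begin

text \<open>
  Write \<open>K\<close> for the closed convex cone of directions \<open>h\<close> with \<open>A h = 0\<close> and \<open>h\<^sub>j \<ge> 0\<close> on the zero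
  indices of \<open>xbar\<close>. All three conditions say that \<open>p \<bullet> h < 0\<close> for every nonzero \<open>h \<in> K\<close>; for (ii)
  this is immediate, as \<open>p \<bullet> 0 = 0\<close>.

  For (i), \<open>K\<close> is the cone of feasible directions of the linear program at \<open>xbar\<close>: the difference
  between a feasible point and \<open>xbar\<close> lies in \<open>K\<close> (lemma \<open>feasible_diff\<close>), and conversely a
  sufficiently short step from \<open>xbar\<close> along a direction in \<open>K\<close> stays feasible, because only
  finitely many sign constraints have to be watched (lemma \<open>feasible_short_step\<close>). Hence moving to
  another feasible point always costs something exactly when moving along \<open>K\<close> does.

  For (iii), let \<open>p \<bullet> h < 0\<close> on \<open>K - {0}\<close>. The unit vectors in \<open>K\<close> form a compact set, so
  homogeneity improves this to \<open>p \<bullet> h \<le> - c \<parallel>h\<parallel>\<close> for some \<open>c > 0\<close>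
  (lemma \<open>uniformly_negative_on_closed_cone\<close>), and this margin absorbs a small perturbation of \<open>p\<close>
  by Cauchy--Schwarz. Conversely, a given \<open>h \<in> K - {0}\<close> is itself a perturbation direction: if
  \<open>0\<close> is optimal for \<open>p + \<delta> h\<close>, then \<open>p \<bullet> h \<le> - \<delta> \<parallel>h\<parallel>\<^sup>2 < 0\<close>.
\<close>

lemma optimal_solution_iff:
  "optimal_solution f F x \<longleftrightarrow> x \<in> F \<and> (\<forall>y\<in>F. f y \<le> f x)"
  by (auto simp: optimal_solution_def is_arg_max_linorder)

lemma unique_optimal_solution_iff:
  "unique_optimal_solution f F x \<longleftrightarrow> x \<in> F \<and> (\<forall>y\<in>F. y \<noteq> x \<longrightarrow> f y < f x)"
proof
  assume unique: "unique_optimal_solution f F x"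
  have "f y < f x" if "y \<in> F" "y \<noteq> x" for y
  proof (rule ccontr)
    assume "\<not> f y < f x"
    then have "f x \<le> f y"
      by simp
    moreover have "\<forall>z\<in>F. f z \<le> f x"
      using unique by (simp add: unique_optimal_solution_def optimal_solution_iff)
    ultimately have "optimal_solution f F y"
      using \<open>y \<in> F\<close> by (auto simp: optimal_solution_iff intro: order_trans)
    with unique \<open>y \<noteq> x\<close> show False
      by (simp add: unique_optimal_solution_def)
  qed
  with unique show "x \<in> F \<and> (\<forall>y\<in>F. y \<noteq> x \<longrightarrow> f y < f x)"
    by (simp add: unique_optimal_solution_def optimal_solution_iff)
next
  assume strict: "x \<in> F \<and> (\<forall>y\<in>F. y \<noteq> x \<longrightarrow> f y < f x)"
  then have "optimal_solution f F x"
    by (auto simp: optimal_solution_iff less_eq_real_def)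
  moreover have "y = x" if "optimal_solution f F y" for y
    using strict that by (auto simp: optimal_solution_iff not_le[symmetric])
  ultimately show "unique_optimal_solution f F x"
    unfolding unique_optimal_solution_def by blast
qed

text \<open>By homogeneity it is enough to bound \<open>p\<close> on the unit vectors of the cone, which form a
  compact set.\<close>

lemma uniformly_negative_on_closed_cone:
  fixes p :: "'a :: euclidean_space"
  assumes "closed K" "cone K"
    and neg: "\<And>h. h \<in> K \<Longrightarrow> h \<noteq> 0 \<Longrightarrow> p \<bullet> h < 0"
  obtains c where "c > 0" "\<And>h. h \<in> K \<Longrightarrow> p \<bullet> h \<le> - c * norm h"
proof (cases "K \<inter> sphere 0 1 = {}")
  case True
  have "h = 0" if "h \<in> K" for h
  proof (rule ccontr)
    assume "h \<noteq> 0"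
    then have "(1 / norm h) *\<^sub>R h \<in> K \<inter> sphere 0 1"
      using \<open>cone K\<close> that by (auto simp: cone_def)
    with True show False by blast
  qed
  then show ?thesis
    using that[of 1] by force
next
  case False
  have "compact (K \<inter> sphere 0 1)"
    using \<open>closed K\<close> by (simp add: closed_Int_compact)
  moreover have "continuous_on (K \<inter> sphere 0 1) (\<lambda>v. p \<bullet> v)"
    by (intro continuous_intros)
  ultimately obtain u where u: "u \<in> K \<inter> sphere 0 1"
    and max: "\<And>v. v \<in> K \<inter> sphere 0 1 \<Longrightarrow> p \<bullet> v \<le> p \<bullet> u"
    using continuous_attains_sup[OF _ False] by blast
  show ?thesis
  proof (rule that[of "- (p \<bullet> u)"])
    show "- (p \<bullet> u) > 0"
      using neg[of u] u by force
    show "p \<bullet> h \<le> - (- (p \<bullet> u)) * norm h" if "h \<in> K" for h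
    proof (cases "h = 0")
      case False
      then have "(1 / norm h) *\<^sub>R h \<in> K \<inter> sphere 0 1"
        using \<open>cone K\<close> that by (auto simp: cone_def)
      from max[OF this] False show ?thesis
        by (simp add: field_simps)
    qed simp
  qed
qed

text \<open>The uniform margin \<open>c\<close> absorbs any perturbation \<open>\<delta> q\<close> with \<open>\<delta> \<parallel>q\<parallel> \<le> c\<close>. In the other direction
  the perturbation \<open>q = h\<close> penalises \<open>h\<close> itself, which rules out \<open>p \<bullet> h = 0\<close>.\<close>

lemma negative_on_closed_cone_iff_stable:
  fixes p :: "'a :: euclidean_space"
  assumes "closed K" "cone K"
  shows "(\<forall>h\<in>K. h \<noteq> 0 \<longrightarrow> p \<bullet> h < 0) \<longleftrightarrow>
    (\<forall>q. q \<noteq> 0 \<longrightarrow> (\<exists>\<epsilon>>0. \<forall>\<delta>\<in>{0<..<\<epsilon>}. \<forall>h\<in>K. (p + \<delta> *\<^sub>R q) \<bullet> h \<le> 0))"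
    (is "?negative \<longleftrightarrow> ?stable")
proof
  assume ?negative
  then obtain c where c: "c > 0" "\<And>h. h \<in> K \<Longrightarrow> p \<bullet> h \<le> - c * norm h"
    using uniformly_negative_on_closed_cone[OF assms] by metis
  show ?stable
  proof (intro allI impI)
    fix q :: 'a assume "q \<noteq> 0"
    have "(p + \<delta> *\<^sub>R q) \<bullet> h \<le> 0" if \<delta>: "\<delta> \<in> {0<..<c / norm q}" and "h \<in> K" for \<delta> h
    proof -
      have "\<delta> * (q \<bullet> h) \<le> \<delta> * (norm q * norm h)"
        using \<delta> norm_cauchy_schwarz[of q h] by (intro mult_left_mono) auto
      also have "\<dots> = (\<delta> * norm q) * norm h"
        by simp
      also have "\<dots> \<le> c * norm h"
        using \<delta> \<open>q \<noteq> 0\<close> by (intro mult_right_mono) (auto simp: field_simps)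
      finally show ?thesis
        using c(2)[OF \<open>h \<in> K\<close>] by (simp add: inner_add_left)
    qed
    moreover have "c / norm q > 0"
      using \<open>c > 0\<close> \<open>q \<noteq> 0\<close> by simp
    ultimately show "\<exists>\<epsilon>>0. \<forall>\<delta>\<in>{0<..<\<epsilon>}. \<forall>h\<in>K. (p + \<delta> *\<^sub>R q) \<bullet> h \<le> 0"
      by blast
  qed
next
  assume stable: ?stable
  show ?negative
  proof (intro ballI impI)
    fix h assume "h \<in> K" "h \<noteq> 0"
    \<comment> \<open>Perturb in the direction \<open>h\<close> itself.\<close>
    with stable obtain \<epsilon> where "\<epsilon> > 0"
      and \<epsilon>: "\<And>\<delta>. \<delta> \<in> {0<..<\<epsilon>} \<Longrightarrow> (p + \<delta> *\<^sub>R h) \<bullet> h \<le> 0"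
      by metis
    have "p \<bullet> h + \<epsilon> / 2 * (h \<bullet> h) \<le> 0"
      using \<epsilon>[of "\<epsilon> / 2"] \<open>\<epsilon> > 0\<close> by (simp add: inner_add_left)
    moreover have "\<epsilon> / 2 * (h \<bullet> h) > 0"
      using \<open>\<epsilon> > 0\<close> \<open>h \<noteq> 0\<close> by simp
    ultimately show "p \<bullet> h < 0"
      by linarith
  qed
qed

lemma zero_in_direction_feasible: "0 \<in> direction_feasible A J"
  by (simp add: direction_feasible_def)

lemma cone_direction_feasible: "cone (direction_feasible A J)"
  by (simp add: cone_def direction_feasible_def matrix_vector_mult_scaleR)

lemma closed_direction_feasible:
  fixes A :: "real ^ 'n ^ 'm"
  shows "closed (direction_feasible A J)"
proof -
  have "direction_feasible A J = {h. A *v h = 0} \<inter> (\<Inter>j\<in>J. {h. 0 \<le> h $ j})"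
    by (auto simp: direction_feasible_def)
  moreover have "closed {h. A *v h = 0}"
    by (intro closed_Collect_eq continuous_intros linear_continuous_on
        matrix_vector_mul_bounded_linear)
  moreover have "closed {h :: real ^ 'n. 0 \<le> h $ j}" for j
    by (intro closed_Collect_le continuous_intros)
  ultimately show ?thesis
    by (simp add: closed_Int closed_INT)
qed

lemma feasible_diff:
  assumes "x \<in> lp_feasible A b" "y \<in> lp_feasible A b"
  shows "y - x \<in> direction_feasible A (zero_indices x)"
  using assms
  by (simp add: lp_feasible_def direction_feasible_def zero_indices_def
      matrix_vector_mult_diff_distrib)

text \<open>A coordinate that vanishes at \<open>x\<close> cannot decrease along \<open>h\<close>, and a positive coordinate stays
  positive for a while; finitely many coordinates allow a common step length.\<close>

lemma feasible_short_step:
  assumes x: "x \<in> lp_feasible A b" and h: "h \<in> direction_feasible A (zero_indices x)"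
  obtains t where "t > 0" "x + t *\<^sub>R h \<in> lp_feasible A b"
proof -
  have "eventually (\<lambda>t. 0 \<le> x $ j + t * h $ j) (at_right 0)" for j
  proof (cases "x $ j = 0")
    case True
    then have "0 \<le> h $ j"
      using h by (simp add: direction_feasible_def zero_indices_def)
    with True show ?thesis
      by (auto intro: eventually_mono[OF eventually_at_right_less])
  next
    case False
    then have "0 < x $ j"
      using x by (simp add: lp_feasible_def order_less_le)
    moreover have "((\<lambda>t. x $ j + t * h $ j) \<longlongrightarrow> x $ j + 0 * h $ j) (at_right 0)"
      by (intro tendsto_intros)
    ultimately show ?thesis
      by (auto dest!: order_tendstoD(1)[where a = 0] elim: eventually_mono)
  qed
  then have "eventually (\<lambda>t. \<forall>j. 0 \<le> x $ j + t * h $ j) (at_right 0)"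
    by (rule eventually_all_finite)
  then have "eventually (\<lambda>t. t > 0 \<and> (\<forall>j. 0 \<le> x $ j + t * h $ j)) (at_right (0::real))"
    using eventually_at_right_less by (rule eventually_conj[rotated])
  then obtain t where "t > 0" "\<forall>j. 0 \<le> x $ j + t * h $ j"
    using eventually_happens'[OF trivial_limit_at_right_real] by blast
  then show ?thesis
    using x h that
    by (simp add: lp_feasible_def direction_feasible_def matrix_vector_right_distrib
        matrix_vector_mult_scaleR)
qed

text \<open>The sign of \<open>p \<bullet> h\<close> does not change under positive scaling of \<open>h\<close>, so short feasible steps
  already decide it on the whole cone of directions.\<close>

lemma unique_optimal_iff_negative_on_directions:
  assumes x: "x \<in> lp_feasible A b"
  shows "unique_optimal_solution (\<lambda>y. p \<bullet> y) (lp_feasible A b) x \<longleftrightarrow>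
    (\<forall>h\<in>direction_feasible A (zero_indices x). h \<noteq> 0 \<longrightarrow> p \<bullet> h < 0)"
    (is "?unique \<longleftrightarrow> ?negative")
proof
  assume unique: ?unique
  show ?negative
  proof (intro ballI impI)
    fix h assume "h \<in> direction_feasible A (zero_indices x)" "h \<noteq> 0"
    then obtain t where t: "t > 0" "x + t *\<^sub>R h \<in> lp_feasible A b"
      using feasible_short_step[OF x] by blast
    moreover from this \<open>h \<noteq> 0\<close> have "x + t *\<^sub>R h \<noteq> x"
      by simp
    ultimately have "p \<bullet> (x + t *\<^sub>R h) < p \<bullet> x"
      using unique unfolding unique_optimal_solution_iff by blast
    then show "p \<bullet> h < 0"
      using \<open>t > 0\<close> by (simp add: inner_add_right mult_less_0_iff)
  qed
next
  assume negative: ?negative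
  have "p \<bullet> y < p \<bullet> x" if "y \<in> lp_feasible A b" "y \<noteq> x" for y
    using bspec[OF negative feasible_diff[OF x that(1)]] that(2)
    by (simp add: inner_diff_right)
  with x show ?unique
    by (simp add: unique_optimal_solution_iff)
qed

theorem proposition1:
  fixes A :: "real ^ 'n ^ 'm"
    and p :: "real ^ 'n"
    and b :: "real ^ 'm"
    and xbar :: "real ^ 'n"
  assumes "optimal_solution (\<lambda>x. p \<bullet> x) (lp_feasible A b) xbar"
  shows
    "(unique_optimal_solution (\<lambda>x. p \<bullet> x) (lp_feasible A b) xbar
        \<longleftrightarrow> unique_optimal_solution (\<lambda>h. p \<bullet> h) (direction_feasible A (zero_indices xbar)) 0)
     \<and>
     (unique_optimal_solution (\<lambda>h. p \<bullet> h) (direction_feasible A (zero_indices xbar)) 0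
        \<longleftrightarrow> (\<forall>q :: real ^ 'n. q \<noteq> 0 \<longrightarrow>
              (\<exists>\<epsilon> > 0. \<forall>\<delta> \<in> {0<..<\<epsilon>}.
                 optimal_solution (\<lambda>h. (p + \<delta> *\<^sub>R q) \<bullet> h)
                   (direction_feasible A (zero_indices xbar)) 0)))"
proof -
  let ?K = "direction_feasible A (zero_indices xbar)"
  have "xbar \<in> lp_feasible A b"
    using assms by (simp add: optimal_solution_iff)
  note point = unique_optimal_iff_negative_on_directions[OF this, of p]
  have direction: "unique_optimal_solution (\<lambda>h. p \<bullet> h) ?K 0 \<longleftrightarrow> (\<forall>h\<in>?K. h \<noteq> 0 \<longrightarrow> p \<bullet> h < 0)"
    by (simp add: unique_optimal_solution_iff zero_in_direction_feasible)
  have perturbed: "optimal_solution (\<lambda>h. r \<bullet> h) ?K 0 \<longleftrightarrow> (\<forall>h\<in>?K. r \<bullet> h \<le> 0)" for r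
    by (simp add: optimal_solution_iff zero_in_direction_feasible)
  show ?thesis
    unfolding point direction perturbed
    by (intro conjI refl negative_on_closed_cone_iff_stable closed_direction_feasible
        cone_direction_feasible)
qed

end
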